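(* Consider the stochastic APP recursion described in the context, under all the assumptions listed there, and assume moreover that $K$ is strongly convex. Then, for all $k\in\mathbb{N}$, the unique mapping $\mathbf{U}_k:\Omega\to U^{\mathrm{ad}}$ that defines the $k$-th iterate of the stochastic APP algorithm (i.e. $M_k(\omega)=\{\mathbf{U}_k(\omega)\}$ for all $\omega\in\Omega$) is measurable.
   Context: Setting and assumptions. $\mathbb{U}$ is a reflexive separable Banach space with dual $\mathbb{U}^\star$ (dual norm topology, Borel $\sigma$-fields on both), $\langle\cdot,\cdot\rangle$ is the duality pairing; $(\Omega,\mathcal{A},\mathbb{P})$ is a probability space with $\mathcal{A}$ complete for $\mathbb{P}$; $\mathbb{W}$ is a topological vector space with its Borel $\sigma$-field; $U^{\mathrm{ad}}\subset\mathbb{U}$ is non-empty, closed and convex. $j^{C},j^{\Sigma}:\mathbb{U}\times\mathbb{W}\to\mathbb{R}$ are jointly lower semicontinuous and, for all $w\in\mathbb{W}$, $j^{C}(\cdot,w)$ and $j^{\Sigma}(\cdot,w)$ are proper and convex; moreover $j^{C}(\cdot,w)$ is subdifferentiable on an open set containing $U^{\mathrm{ad}}$. $K:\mathbb{U}\to\mathbb{R}$ is proper, convex, lower semicontinuous, and Gateaux-differentiable (with linear bounded directional derivative) on an open set containing $U^{\mathrm{ad}}$. $\mathbf{W}_1,\mathbf{W}_2,\ldots:\Omega\to\mathbb{W}$ are measurable (independent, identically distributed random variables); $\mathbf{R}_k:\Omega\to\mathbb{U}^\star$, $k\in\mathbb{N}$, are measurable; $\varepsilon_k>0$ for all $k\in\mathbb{N}$;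 $u_0\in U^{\mathrm{ad}}$. Stochastic APP recursion. $M_0(\omega)=\{u_0\}$ for all $\omega$. For $k\in\mathbb{N}$, given a measurable selection $\mathbf{U}_k:\Omega\to U^{\mathrm{ad}}$ of $M_k$, let $\mathbf{G}_k:\Omega\to\mathbb{U}^\star$ be a measurable mapping with $\mathbf{G}_k(\omega)\in\partial_u j^{C}(\mathbf{U}_k(\omega),\mathbf{W}_{k+1}(\omega))$ for all $\omega$ (such a mapping exists under the present assumptions; it is regarded as fixed), and set $$M_{k+1}(\omega)=\operatorname*{arg\,min}_{u\in U^{\mathrm{ad}}}\;K(u)+\big\langle\varepsilon_k(\mathbf{G}_k(\omega)+\mathbf{R}_k(\omega))-\nabla K(\mathbf{U}_k(\omega)),u\big\rangle+\varepsilon_k\,j^{\Sigma}(u,\mathbf{W}_{k+1}(\omega)).$$ It is assumed that at every iteration $k$ and for all $\omega$ the function of $u$ being minimized is coercive on $U^{\mathrm{ad}}$ (it tends to $+\infty$ when $\|u\|\to+\infty$, $u\in U^{\mathrm{ad}}$). $K$ is strongly convex if there is $b>0$ with $K(tu+(1-t)v)\le tK(u)+(1-t)K(v)-\frac{b}{2}t(1-t)\|u-v\|^2$ for all $u,v\in\mathbb{U}$, $t\in[0,1]$. $\partial_u$ denotes the convex subdifferential in $u$ over all of $\mathbb{U}$. *)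

theory Defs
  imports "HOL-Probability.Probability"
begin

text \<open>No separation axiom is imposed.\<close>
class real_topological_vector_space = real_vector + topological_ab_group_add +
  assumes tendsto_scaleR_Pair:
    "filterlim (\<lambda>x. fst x *\<^sub>R snd x) (nhds (c *\<^sub>R a)) (nhds c \<times>\<^sub>F nhds a)"

text \<open>The canonical embedding into the bidual is always isometric, so reflexivity is its
  surjectivity.\<close>
definition reflexive_space :: "'u::real_normed_vector itself \<Rightarrow> bool" where
  "reflexive_space _ \<longleftrightarrow>
     (\<forall>\<Phi> :: ('u \<Rightarrow>\<^sub>L real) \<Rightarrow>\<^sub>L real. \<exists>u::'u. \<forall>g. blinfun_apply \<Phi> g = blinfun_apply g u)"

definition lower_semicontinuous :: "('a::topological_space \<Rightarrow> real) \<Rightarrow> bool" where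
  "lower_semicontinuous f \<longleftrightarrow> (\<forall>x a. a < f x \<longrightarrow> (\<forall>\<^sub>F y in nhds x. a < f y))"

text \<open>Only meaningful for extended-real-valued functions; for a real-valued function, viewed in
  the extended reals, it holds automatically.\<close>
definition proper_fun :: "('a \<Rightarrow> ereal) \<Rightarrow> bool" where
  "proper_fun f \<longleftrightarrow> (\<forall>x. f x \<noteq> -\<infinity>) \<and> (\<exists>x. f x \<noteq> \<infinity>)"

definition strongly_convex :: "('u::real_normed_vector \<Rightarrow> real) \<Rightarrow> bool" where
  "strongly_convex f \<longleftrightarrow> (\<exists>b>0. \<forall>u v. \<forall>t\<in>{0..1}.
     f (t *\<^sub>R u + (1 - t) *\<^sub>R v)
       \<le> t * f u + (1 - t) * f v - b / 2 * t * (1 - t) * (norm (u - v))\<^sup>2)"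

definition subdifferential :: "('u::real_normed_vector \<Rightarrow> real) \<Rightarrow> 'u \<Rightarrow> ('u \<Rightarrow>\<^sub>L real) set" where
  "subdifferential f u = {g. \<forall>v. f u + blinfun_apply g (v - u) \<le> f v}"

definition has_gateaux_gradient ::
    "('u::real_normed_vector \<Rightarrow> real) \<Rightarrow> ('u \<Rightarrow>\<^sub>L real) \<Rightarrow> 'u \<Rightarrow> bool" where
  "has_gateaux_gradient f g u \<longleftrightarrow>
     (\<forall>h. ((\<lambda>t. (f (u + t *\<^sub>R h) - f u) / t) \<longlongrightarrow> blinfun_apply g h) (at 0))"

text \<open>Unspecified at points where no Gateaux gradient exists.\<close>
definition gateaux_gradient :: "('u::real_normed_vector \<Rightarrow> real) \<Rightarrow> 'u \<Rightarrow> ('u \<Rightarrow>\<^sub>L real)" where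
  "gateaux_gradient f u = (THE g. has_gateaux_gradient f g u)"

text \<open>The function of \<open>u\<close> minimised in one step, at the iterate \<open>u'\<close>, with subgradient \<open>g\<close>,
  perturbation \<open>r\<close>, step size \<open>e\<close> and noise value \<open>w\<close>.\<close>
definition app_objective ::
    "('u::real_normed_vector \<Rightarrow> real) \<Rightarrow> ('u \<Rightarrow> 'w \<Rightarrow> real) \<Rightarrow> real \<Rightarrow> 'u \<Rightarrow> ('u \<Rightarrow>\<^sub>L real)
      \<Rightarrow> ('u \<Rightarrow>\<^sub>L real) \<Rightarrow> 'w \<Rightarrow> 'u \<Rightarrow> real" where
  "app_objective K jS e u' g r w u =
     K u + blinfun_apply (e *\<^sub>R (g + r) - gateaux_gradient K u') u + e * jS u w"

definition coercive_on :: "'u::real_normed_vector set \<Rightarrow> ('u \<Rightarrow> real) \<Rightarrow> bool" where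
  "coercive_on A f \<longleftrightarrow> filterlim f at_top (inf at_infinity (principal A))"

definition measurable_selection ::
    "'a measure \<Rightarrow> ('a \<Rightarrow> 'u::topological_space set) \<Rightarrow> ('a \<Rightarrow> 'u) \<Rightarrow> bool" where
  "measurable_selection P M U \<longleftrightarrow> U \<in> borel_measurable P \<and> (\<forall>\<omega>\<in>space P. U \<omega> \<in> M \<omega>)"

text \<open>A run of the stochastic APP algorithm, with argmin sets \<open>M k\<close>, iterates \<open>U k\<close> and
  subgradients \<open>G k\<close>.  The iterate \<open>U k\<close> is a measurable selection of \<open>M k\<close> provided there is one,
  and only then are the requirements on \<open>G k\<close> imposed; so neither non-emptiness of \<open>M k\<close> nor
  existence of a measurable selection is built in.\<close>
definition stochastic_app_run ::
    "'a measure \<Rightarrow> 'u::real_normed_vector set \<Rightarrow> ('u \<Rightarrow> real) \<Rightarrow> ('u \<Rightarrow> 'w \<Rightarrow> real)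
      \<Rightarrow> ('u \<Rightarrow> 'w \<Rightarrow> real) \<Rightarrow> (nat \<Rightarrow> real) \<Rightarrow> (nat \<Rightarrow> 'a \<Rightarrow> 'w) \<Rightarrow> (nat \<Rightarrow> 'a \<Rightarrow> 'u \<Rightarrow>\<^sub>L real) \<Rightarrow> 'u
      \<Rightarrow> (nat \<Rightarrow> 'a \<Rightarrow> 'u set) \<Rightarrow> (nat \<Rightarrow> 'a \<Rightarrow> 'u) \<Rightarrow> (nat \<Rightarrow> 'a \<Rightarrow> 'u \<Rightarrow>\<^sub>L real) \<Rightarrow> bool" where
  "stochastic_app_run P Uad K jC jS \<epsilon> W R u0 M U G \<longleftrightarrow>
     (\<forall>\<omega>\<in>space P. M 0 \<omega> = {u0}) \<and>
     (\<forall>k. (\<exists>V. measurable_selection P (M k) V) \<longrightarrow> measurable_selection P (M k) (U k)) \<and>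
     (\<forall>k. measurable_selection P (M k) (U k) \<longrightarrow>
        G k \<in> borel_measurable P \<and>
        (\<forall>\<omega>\<in>space P. G k \<omega> \<in> subdifferential (\<lambda>u. jC u (W (Suc k) \<omega>)) (U k \<omega>)) \<and>
        (\<forall>\<omega>\<in>space P. M (Suc k) \<omega> =
           {u. is_arg_min (app_objective K jS (\<epsilon> k) (U k \<omega>) (G k \<omega>) (R k \<omega>) (W (Suc k) \<omega>))
                 (\<lambda>u. u \<in> Uad) u}))"

end

theory Submission
  imports Defs
begin

text \<open>By induction on \<open>k\<close> it suffices to treat one step: if \<open>U k\<close> is measurable, then the function
  \<open>F \<omega>\<close> minimised at step \<open>k\<close> has exactly one minimiser \<open>V \<omega>\<close> on \<open>Uad\<close>, and \<open>V\<close> is measurable.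
  The run then has a measurable selection of \<open>M (Suc k)\<close>, namely \<open>V\<close>, so \<open>U (Suc k)\<close> is one too and,
  the argmin set being a singleton, coincides with \<open>V\<close>.

  Adding the convex function \<open>\<langle>\<cdot>, u\<rangle> + \<epsilon> j\<^sup>\<Sigma>(u, w)\<close> to \<open>K\<close> keeps the strong convexity.  Strong
  convexity makes every minimising sequence in \<open>Uad\<close> a Cauchy sequence, so that a minimiser exists
  by completeness of the space
  (\<open>strongly_convex_minimizer_exists\<close>), and every other minimising sequence converges to it, by
  quadratic growth around it (\<open>strongly_convex_quadratic_growth\<close>).

  For measurability, \<open>F\<close> is a Caratheodory function.  In \<open>u\<close> it is continuous, since a finite convex
  lower semicontinuous function on a Banach space is continuous by the Baire category theorem
  (\<open>convex_lower_semicontinuous_imp_continuous\<close>).  In \<open>\<omega>\<close> it is measurable: the noise enters through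
  a lower semicontinuous function of \<open>w\<close>, and the gradient term, tested against a fixed direction, is
  a limit of difference quotients of \<open>K\<close>.  Hence on a countable dense subset of \<open>Uad\<close> the first point
  at which \<open>F \<omega>\<close> is within \<open>1 / Suc j\<close> of its infimum depends measurably on \<open>\<omega>\<close>; as \<open>j\<close> grows, these
  points form a minimising sequence, and \<open>V \<omega>\<close> is their limit
  (\<open>measurable_strongly_convex_arg_min\<close>).\<close>

section \<open>Lower semicontinuous functions\<close>

lemma lower_semicontinuous_section:
  fixes f :: "'a::topological_space \<Rightarrow> 'b::topological_space \<Rightarrow> real"
  assumes "lower_semicontinuous (\<lambda>(x, y). f x y)"
  shows "lower_semicontinuous (\<lambda>x. f x y)" and "lower_semicontinuous (f x)"
proof -
  have lsc: "\<forall>\<^sub>F z in nhds (x, y). a < (case z of (x, y) \<Rightarrow> f x y)" if "a < f x y" for x y a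
    using assms that unfolding lower_semicontinuous_def by auto
  show "lower_semicontinuous (\<lambda>x. f x y)"
    unfolding lower_semicontinuous_def
  proof (intro allI impI)
    fix x a assume "a < f x y"
    moreover have "((\<lambda>x'. (x', y)) \<longlongrightarrow> (x, y)) (nhds x)"
      by (intro tendsto_intros filterlim_ident)
    ultimately show "\<forall>\<^sub>F x' in nhds x. a < f x' y"
      using lsc[of a x y] by (auto simp: filterlim_iff)
  qed
  show "lower_semicontinuous (f x)"
    unfolding lower_semicontinuous_def
  proof (intro allI impI)
    fix y a assume "a < f x y"
    moreover have "((\<lambda>y'. (x, y')) \<longlongrightarrow> (x, y)) (nhds y)"
      by (intro tendsto_intros filterlim_ident)
    ultimately show "\<forall>\<^sub>F y' in nhds y. a < f x y'"
      using lsc[of a x y] by (auto simp: filterlim_iff)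
  qed
qed

lemma open_superlevel_lower_semicontinuous:
  assumes "lower_semicontinuous f"
  shows "open {x. a < f x}"
proof -
  have "\<exists>T. open T \<and> x \<in> T \<and> T \<subseteq> {x. a < f x}" if "a < f x" for x
  proof -
    have "\<forall>\<^sub>F y in nhds x. a < f y"
      using assms that by (simp add: lower_semicontinuous_def)
    then show ?thesis by (auto simp: eventually_nhds)
  qed
  then show ?thesis
    by (subst open_subopen) blast
qed

lemma borel_measurable_lower_semicontinuous:
  assumes "lower_semicontinuous f"
  shows "f \<in> borel_measurable borel"
  unfolding borel_measurable_iff_greater
  using open_superlevel_lower_semicontinuous[OF assms] by simp

lemma continuous_imp_lower_semicontinuous:
  fixes f :: "'a::topological_space \<Rightarrow> real"
  assumes "continuous_on UNIV f"
  shows "lower_semicontinuous f"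
  unfolding lower_semicontinuous_def
proof (intro allI impI)
  fix x a assume "a < f x"
  moreover have "open {y. a < f y}"
    using assms by (intro open_Collect_less continuous_on_const)
  ultimately show "\<forall>\<^sub>F y in nhds x. a < f y"
    using eventually_nhds by blast
qed

text \<open>The closed sublevel sets \<open>{u. f u \<le> n}\<close> cover the space, so by Baire one of them contains a
  ball \<open>ball y r\<close>.  Convexity carries the upper bound from there to a neighbourhood of any \<open>x\<close>, since
  \<open>x\<close> is the midpoint of \<open>y\<close> and of its reflection \<open>2 x - y\<close>; lower semicontinuity bounds \<open>f\<close> from below
  near \<open>x\<close>, and a convex function bounded on an open set is continuous there.\<close>

lemma convex_lower_semicontinuous_imp_continuous:
  fixes f :: "'u::banach \<Rightarrow> real"
  assumes cvx: "convex_on UNIV f" and lsc: "lower_semicontinuous f"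
  shows "continuous_on UNIV f"
proof -
  have closed: "closed {u. f u \<le> c}" for c
    using open_superlevel_lower_semicontinuous[OF lsc, of c]
    by (simp add: closed_def Collect_neg_eq[symmetric] not_le)
  obtain N :: nat where N: "interior {u. f u \<le> real N} \<noteq> {}"
  proof (rule ccontr)
    assume "\<not> thesis"
    then have "\<forall>n::nat. interior {u. f u \<le> real n} = {}" using that by blast
    then have "euclidean interior_of (\<Union>n::nat. {u. f u \<le> real n}) = {}"
      using closed complete_UNIV Met_TC.metric_Baire_category_alt
          [where 'a = 'u, of "range (\<lambda>n::nat. {u. f u \<le> real n})"]
      by auto
    moreover have "(\<Union>n::nat. {u. f u \<le> real n}) = UNIV"
      using real_arch_simple by auto
    ultimately show False by simp
  qed
  obtain y r where "r > 0" and ball: "ball y r \<subseteq> {u. f u \<le> real N}"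
    using N by (meson ex_in_conv mem_interior)
  have "isCont f x" for x
  proof -
    define z where "z = 2 *\<^sub>R x - y"
    have upper: "f v \<le> (real N + f z) / 2" if "v \<in> ball x (r / 2)" for v
    proof -
      define y' where "y' = y + 2 *\<^sub>R (v - x)"
      have "dist y y' = 2 * dist x v"
        by (simp add: y'_def dist_norm norm_minus_commute)
      then have "y' \<in> ball y r" using that by simp
      then have "f y' \<le> real N" using ball by blast
      moreover have v: "v = (1 - 1/2) *\<^sub>R y' + (1/2) *\<^sub>R z"
        by (simp add: y'_def z_def algebra_simps)
      have "f v \<le> (1 - 1/2) * f y' + (1/2) * f z"
        by (subst v, rule convex_onD[OF cvx]) auto
      ultimately show ?thesis by simp
    qed
    have "\<forall>\<^sub>F v in nhds x. f x - 1 < f v"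
      using lsc unfolding lower_semicontinuous_def by simp
    then obtain s where "s > 0" and lower: "\<And>v. v \<in> ball x s \<Longrightarrow> f x - 1 < f v"
      by (auto simp: eventually_nhds_metric dist_commute)
    define q where "q = min s (r / 2)"
    have "q > 0" using \<open>s > 0\<close> \<open>r > 0\<close> by (simp add: q_def)
    have "\<forall>v\<in>ball x q. \<bar>f v\<bar> \<le> \<bar>(real N + f z) / 2\<bar> + \<bar>f x - 1\<bar>"
    proof
      fix v assume "v \<in> ball x q"
      then have "v \<in> ball x (r / 2)" "v \<in> ball x s"
        by (auto simp: q_def)
      then show "\<bar>f v\<bar> \<le> \<bar>(real N + f z) / 2\<bar> + \<bar>f x - 1\<bar>"
        using upper[of v] lower[of v] by linarith
    qed
    then have "continuous_on (ball x q) f"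
      using convex_on_bounded_continuous[OF open_ball convex_on_subset[OF cvx]] by auto
    then show ?thesis
      using \<open>q > 0\<close> by (simp add: continuous_on_eq_continuous_at)
  qed
  then show ?thesis by (simp add: continuous_at_imp_continuous_on)
qed

section \<open>Minimisation of strongly convex functions\<close>

lemma strongly_convex_imp_convex:
  fixes f :: "'u::real_normed_vector \<Rightarrow> real"
  assumes "strongly_convex f"
  shows "convex_on UNIV f"
proof (rule convex_onI)
  obtain b where "b > 0" and b: "\<And>u v t. t \<in> {0..1} \<Longrightarrow> f (t *\<^sub>R u + (1 - t) *\<^sub>R v)
       \<le> t * f u + (1 - t) * f v - b / 2 * t * (1 - t) * (norm (u - v))\<^sup>2"
    using assms unfolding strongly_convex_def by blast
  fix t :: real and x y :: 'u assume "0 < t" "t < 1"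
  moreover from this have "0 \<le> b / 2 * t * (1 - t) * (norm (y - x))\<^sup>2"
    using \<open>b > 0\<close> by simp
  ultimately show "f ((1 - t) *\<^sub>R x + t *\<^sub>R y) \<le> (1 - t) * f x + t * f y"
    using b[of t y x] by (simp add: add.commute)
qed simp

lemma strongly_convex_add_convex:
  assumes f: "strongly_convex f" and g: "convex_on UNIV g"
  shows "strongly_convex (\<lambda>u. f u + g u)"
proof -
  obtain b where "b > 0" and b: "\<And>u v t. t \<in> {0..1} \<Longrightarrow> f (t *\<^sub>R u + (1 - t) *\<^sub>R v)
       \<le> t * f u + (1 - t) * f v - b / 2 * t * (1 - t) * (norm (u - v))\<^sup>2"
    using f unfolding strongly_convex_def by blast
  have "f (t *\<^sub>R u + (1 - t) *\<^sub>R v) + g (t *\<^sub>R u + (1 - t) *\<^sub>R v)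
      \<le> t * (f u + g u) + (1 - t) * (f v + g v) - b / 2 * t * (1 - t) * (norm (u - v))\<^sup>2"
    if "t \<in> {0..1}" for u v t
    using b[OF that, of u v] convex_onD[OF g, of t v u] that by (simp add: algebra_simps)
  then show ?thesis
    unfolding strongly_convex_def using \<open>b > 0\<close> by blast
qed

lemma strongly_convex_midpoint:
  assumes "strongly_convex f"
  obtains b where "b > 0"
    and "\<And>u v. b / 8 * (norm (u - v))\<^sup>2 \<le> (f u + f v) / 2 - f ((1/2) *\<^sub>R u + (1/2) *\<^sub>R v)"
proof -
  obtain b where "b > 0" and b: "\<And>u v t. t \<in> {0..1} \<Longrightarrow> f (t *\<^sub>R u + (1 - t) *\<^sub>R v)
       \<le> t * f u + (1 - t) * f v - b / 2 * t * (1 - t) * (norm (u - v))\<^sup>2"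
    using assms unfolding strongly_convex_def by blast
  have "b / 8 * (norm (u - v))\<^sup>2 \<le> (f u + f v) / 2 - f ((1/2) *\<^sub>R u + (1/2) *\<^sub>R v)" for u v
    using b[of "1/2" u v] by (simp add: algebra_simps)
  then show ?thesis using that \<open>b > 0\<close> by blast
qed

text \<open>A point \<open>u\<close> at distance \<open>d\<close> from the origin is compared with the point of its segment to the
  origin that has norm \<open>r\<close>, where \<open>r\<close> is so small that \<open>f\<close> exceeds \<open>f 0 - 1\<close> on the ball of radius \<open>r\<close>.
  Strong convexity turns this into a lower bound for \<open>f u\<close> that is a quadratic polynomial in \<open>d\<close> with
  leading coefficient \<open>b / 2 > 0\<close>; completing the square bounds it.\<close>

lemma strongly_convex_bounded_below:
  assumes sc: "strongly_convex f" and lsc: "lower_semicontinuous f"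
  shows "bdd_below (range f)"
proof -
  obtain b where "b > 0" and b: "\<And>u v t. t \<in> {0..1} \<Longrightarrow> f (t *\<^sub>R u + (1 - t) *\<^sub>R v)
       \<le> t * f u + (1 - t) * f v - b / 2 * t * (1 - t) * (norm (u - v))\<^sup>2"
    using sc unfolding strongly_convex_def by blast
  have "\<forall>\<^sub>F v in nhds 0. f 0 - 1 < f v"
    using lsc unfolding lower_semicontinuous_def by simp
  then obtain s where "s > 0" and s: "\<And>v. norm v < s \<Longrightarrow> f 0 - 1 < f v"
    by (auto simp: eventually_nhds_metric)
  define r where "r = s / 2"
  have "r > 0" "r < s" using \<open>s > 0\<close> by (auto simp: r_def)
  have "f 0 - 1 - (1 / r + b / 2 * r)\<^sup>2 / (2 * b) \<le> f u" for u
  proof (cases "norm u < s")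
    case True
    have "0 \<le> (1 / r + b / 2 * r)\<^sup>2 / (2 * b)" using \<open>b > 0\<close> by simp
    with s[OF True] show ?thesis by linarith
  next
    case False
    define d where "d = norm u"
    define t where "t = r / d"
    have "d > 0" "r < d" using False \<open>r < s\<close> \<open>s > 0\<close> by (auto simp: d_def)
    then have t: "t \<in> {0..1}" "t > 0" using \<open>r > 0\<close> by (auto simp: t_def)
    have "norm (t *\<^sub>R u) = r" using \<open>d > 0\<close> \<open>r > 0\<close> by (simp add: t_def d_def)
    then have "f 0 - 1 < f (t *\<^sub>R u)" using s \<open>r < s\<close> by simp
    also have "\<dots> \<le> t * f u + (1 - t) * f 0 - b / 2 * t * (1 - t) * d\<^sup>2"
      using b[OF t(1), of u 0] by (simp add: d_def)
    finally have "t * f 0 - 1 + b / 2 * t * (1 - t) * d\<^sup>2 \<le> t * f u"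
      by (simp add: algebra_simps)
    then have "(t * f 0 - 1 + b / 2 * t * (1 - t) * d\<^sup>2) / t \<le> f u"
      using \<open>t > 0\<close> by (simp add: field_simps)
    moreover have "(t * f 0 - 1 + b / 2 * t * (1 - t) * d\<^sup>2) / t = f 0 - 1/t + b / 2 * (1 - t) * d\<^sup>2"
      using \<open>t > 0\<close> by (simp add: field_simps)
    moreover have "f 0 - 1/t + b / 2 * (1 - t) * d\<^sup>2 = f 0 - (1 / r + b / 2 * r) * d + b / 2 * d\<^sup>2"
      using \<open>d > 0\<close> \<open>r > 0\<close> by (simp add: t_def field_simps power2_eq_square)
    \<comment> \<open>completing the square in \<open>d\<close>\<close>
    moreover have "b / 2 * d\<^sup>2 - (1 / r + b / 2 * r) * d + (1 / r + b / 2 * r)\<^sup>2 / (2 * b)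
        = (b * d - (1 / r + b / 2 * r))\<^sup>2 / (2 * b)"
      using \<open>b > 0\<close> by (simp add: field_simps power2_eq_square)
    moreover have "0 \<le> (b * d - (1 / r + b / 2 * r))\<^sup>2 / (2 * b)" using \<open>b > 0\<close> by simp
    ultimately show ?thesis by linarith
  qed
  then show ?thesis by (auto intro!: bdd_belowI2)
qed

lemma lower_semicontinuous_limit_le:
  assumes "lower_semicontinuous f" "s \<longlonglongrightarrow> x" "(\<lambda>n. f (s n)) \<longlonglongrightarrow> c"
  shows "f x \<le> c"
proof (rule ccontr)
  assume "\<not> f x \<le> c"
  then obtain a where "c < a" "a < f x" using dense not_le by metis
  then have "\<forall>\<^sub>F y in nhds x. a < f y"
    using assms(1) by (simp add: lower_semicontinuous_def)
  then have "\<forall>\<^sub>F n in sequentially. a < f (s n)"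
    using assms(2) unfolding filterlim_iff by blast
  moreover have "\<forall>\<^sub>F n in sequentially. f (s n) < a"
    using order_tendstoD(2)[OF assms(3) \<open>c < a\<close>] .
  ultimately have "\<forall>\<^sub>F n::nat in sequentially. False"
    by eventually_elim simp
  then show False by simp
qed

text \<open>The value at the midpoint of two almost minimisers is at least the infimum, because the set is
  convex; the midpoint inequality then forces them to be close to each other.\<close>

lemma strongly_convex_minimizer_exists:
  fixes f :: "'u::banach \<Rightarrow> real"
  assumes sc: "strongly_convex f" and lsc: "lower_semicontinuous f"
    and A: "closed A" "convex A" "A \<noteq> {}"
  obtains x where "x \<in> A" and "\<And>u. u \<in> A \<Longrightarrow> f x \<le> f u"
proof -
  define m where "m = Inf (f ` A)"
  have bdd: "bdd_below (f ` A)"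
    using strongly_convex_bounded_below[OF sc lsc] by (rule bdd_below_mono) auto
  have m_le: "m \<le> f u" if "u \<in> A" for u
    unfolding m_def using that bdd by (intro cInf_lower) auto
  have "\<exists>u\<in>A. f u < m + 1 / real (Suc n)" for n
    using cInf_lessD[of "f ` A" "m + 1 / real (Suc n)"] A(3) by (auto simp: m_def)
  then obtain s where sA: "\<And>n. s n \<in> A" and s: "\<And>n. f (s n) < m + 1 / real (Suc n)"
    by metis
  obtain b where "b > 0" and b: "\<And>u v. b / 8 * (norm (u - v))\<^sup>2
      \<le> (f u + f v) / 2 - f ((1/2) *\<^sub>R u + (1/2) *\<^sub>R v)"
    using strongly_convex_midpoint[OF sc] by blast
  have close: "b / 8 * (norm (s i - s j))\<^sup>2 \<le> 1 / real (Suc n)" if "i \<ge> n" "j \<ge> n" for i j n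
  proof -
    have "m \<le> f ((1/2) *\<^sub>R s i + (1/2) *\<^sub>R s j)"
      using convexD[OF A(2) sA sA, of "1/2" "1/2"] by (intro m_le) auto
    moreover have "1 / real (Suc i) \<le> 1 / real (Suc n)" "1 / real (Suc j) \<le> 1 / real (Suc n)"
      using that by (auto simp: field_simps)
    ultimately show ?thesis
      using b[of "s i" "s j"] s[of i] s[of j] by argo
  qed
  have "Cauchy s"
  proof (rule metric_CauchyI)
    fix e :: real assume "e > 0"
    then have "b / 8 * e\<^sup>2 > 0" using \<open>b > 0\<close> by simp
    then obtain n where n: "1 / real (Suc n) < b / 8 * e\<^sup>2"
      using nat_approx_posE by blast
    have "dist (s i) (s j) < e" if "i \<ge> n" "j \<ge> n" for i j
    proof -
      have "b / 8 * (norm (s i - s j))\<^sup>2 < b / 8 * e\<^sup>2"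
        using close[OF that] n by linarith
      then have "(norm (s i - s j))\<^sup>2 < e\<^sup>2"
        using \<open>b > 0\<close> by simp
      then show ?thesis
        using \<open>e > 0\<close> by (simp add: dist_norm power_less_imp_less_base)
    qed
    then show "\<exists>n. \<forall>i\<ge>n. \<forall>j\<ge>n. dist (s i) (s j) < e" by blast
  qed
  then obtain x where x: "s \<longlonglongrightarrow> x"
    using Cauchy_convergent_iff convergent_def by blast
  have upper_lim: "(\<lambda>n. m + 1 / real (Suc n)) \<longlonglongrightarrow> m"
    using tendsto_add[OF tendsto_const[of m] LIMSEQ_Suc[OF lim_1_over_n]] by simp
  have "(\<lambda>n. f (s n)) \<longlonglongrightarrow> m"
    by (rule tendsto_sandwich[OF _ _ tendsto_const upper_lim])
      (intro always_eventually allI m_le sA less_imp_le[OF s])+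
  then have "f x \<le> m" by (rule lower_semicontinuous_limit_le[OF lsc x])
  moreover have "x \<in> A" using closed_sequentially[OF A(1) sA x] .
  ultimately show ?thesis using that m_le by force
qed

text \<open>Apply the midpoint inequality to \<open>u\<close> and the minimiser: their midpoint does not improve on the
  minimum.\<close>

lemma strongly_convex_quadratic_growth:
  assumes sc: "strongly_convex f" and "convex A"
    and x: "x \<in> A" "\<And>u. u \<in> A \<Longrightarrow> f x \<le> f u"
  obtains b where "b > 0" and "\<And>u. u \<in> A \<Longrightarrow> b * (norm (u - x))\<^sup>2 \<le> f u - f x"
proof -
  obtain b where "b > 0" and b: "\<And>u v. b / 8 * (norm (u - v))\<^sup>2
      \<le> (f u + f v) / 2 - f ((1/2) *\<^sub>R u + (1/2) *\<^sub>R v)"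
    using strongly_convex_midpoint[OF sc] by blast
  have "b / 4 * (norm (u - x))\<^sup>2 \<le> f u - f x" if "u \<in> A" for u
  proof -
    have "f x \<le> f ((1/2) *\<^sub>R u + (1/2) *\<^sub>R x)"
      using convexD[OF \<open>convex A\<close> that x(1), of "1/2" "1/2"] by (intro x(2)) auto
    then show ?thesis using b[of u x] by argo
  qed
  then show ?thesis using that[of "b / 4"] \<open>b > 0\<close> by simp
qed

section \<open>Measurability of the minimiser\<close>

text \<open>A dense countable set of the whole space may miss a set \<open>A\<close> with empty interior, so its points
  are replaced by nearby points of \<open>A\<close>, one for each tolerance \<open>1 / Suc n\<close>.\<close>

lemma countable_dense_subset_of:
  fixes A :: "'u::metric_space set"
  assumes "separable_space (euclidean :: 'u topology)"
  obtains D where "countable D" "D \<subseteq> A"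
    and "\<And>x e. x \<in> A \<Longrightarrow> e > 0 \<Longrightarrow> \<exists>d\<in>D. dist d x < e"
proof -
  obtain C :: "'u set" where "countable C" and C: "closure C = UNIV"
    using assms by (auto simp: separable_space_def)
  define I where "I = {(c, n). c \<in> C \<and> (\<exists>a\<in>A. dist a c < 1 / real (Suc n))}"
  have "\<forall>i\<in>I. \<exists>a\<in>A. dist a (fst i) < 1 / real (Suc (snd i))"
    by (auto simp: I_def)
  then obtain p where p: "\<And>i. i \<in> I \<Longrightarrow> p i \<in> A \<and> dist (p i) (fst i) < 1 / real (Suc (snd i))"
    by metis
  show ?thesis
  proof
    have "I \<subseteq> C \<times> UNIV" by (auto simp: I_def)
    then have "countable I"
      using \<open>countable C\<close> by (meson countable_SIGMA countable_subset uncountable_def countableI_type)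
    then show "countable (p ` I)" by simp
    show "p ` I \<subseteq> A" using p by auto
    fix x e assume "x \<in> A" "e > (0::real)"
    obtain n where n: "1 / real (Suc n) < e / 2"
      using nat_approx_posE[of "e / 2"] \<open>e > 0\<close> by auto
    have "x \<in> closure C" using C by simp
    then obtain c where c: "c \<in> C" "dist c x < 1 / real (Suc n)"
      using closure_approachable[of x C] by (metis of_nat_0_less_iff zero_less_Suc zero_less_divide_1_iff)
    then have "(c, n) \<in> I" using \<open>x \<in> A\<close> by (auto simp: I_def dist_commute)
    moreover from p[OF this] have "dist (p (c, n)) x < e"
      using dist_triangle[of "p (c, n)" x c] c n by auto
    ultimately show "\<exists>d\<in>p ` I. dist d x < e" by blast
  qed
qed

text \<open>The limit of the minimising sequences \<open>d (N j \<omega>)\<close> is measurable because each \<open>N j\<close> is a least index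
  defined by countably many measurable conditions.\<close>

lemma measurable_strongly_convex_arg_min:
  fixes A :: "'u::banach set" and F :: "'a \<Rightarrow> 'u \<Rightarrow> real"
  assumes sep: "separable_space (euclidean :: 'u topology)"
    and A: "closed A" "convex A" "A \<noteq> {}"
    and meas: "\<And>u. u \<in> A \<Longrightarrow> (\<lambda>\<omega>. F \<omega> u) \<in> borel_measurable P"
    and sc: "\<And>\<omega>. \<omega> \<in> space P \<Longrightarrow> strongly_convex (F \<omega>)"
    and lsc: "\<And>\<omega>. \<omega> \<in> space P \<Longrightarrow> lower_semicontinuous (F \<omega>)"
  obtains V where "V \<in> borel_measurable P"
    and "\<And>\<omega>. \<omega> \<in> space P \<Longrightarrow> {u. is_arg_min (F \<omega>) (\<lambda>u. u \<in> A) u} = {V \<omega>}"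
proof -
  have "\<exists>x. \<omega> \<in> space P \<longrightarrow> x \<in> A \<and> (\<forall>u\<in>A. F \<omega> x \<le> F \<omega> u)" for \<omega>
    using strongly_convex_minimizer_exists[OF sc lsc A] by metis
  then obtain V where V: "\<And>\<omega>. \<omega> \<in> space P \<Longrightarrow> V \<omega> \<in> A"
      "\<And>\<omega> u. \<omega> \<in> space P \<Longrightarrow> u \<in> A \<Longrightarrow> F \<omega> (V \<omega>) \<le> F \<omega> u"
    by metis
  have cont: "isCont (F \<omega>) u" if "\<omega> \<in> space P" for \<omega> u
    using convex_lower_semicontinuous_imp_continuous[OF strongly_convex_imp_convex[OF sc] lsc] that
    by (simp add: continuous_on_eq_continuous_at)
  obtain D where "countable D" "D \<subseteq> A"
    and D: "\<And>x e. x \<in> A \<Longrightarrow> e > 0 \<Longrightarrow> \<exists>d\<in>D. dist d x < e"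
    using countable_dense_subset_of[OF sep] by metis
  have "D \<noteq> {}" using D A(3) zero_less_one by blast
  define d where "d = from_nat_into D"
  have d: "d n \<in> A" for n
    using from_nat_into[OF \<open>D \<noteq> {}\<close>] \<open>D \<subseteq> A\<close> by (auto simp: d_def)
  have approx: "\<exists>n. F \<omega> (d n) < F \<omega> (V \<omega>) + e" if "\<omega> \<in> space P" "e > 0" for \<omega> e
  proof -
    have "\<forall>\<^sub>F u in nhds (V \<omega>). F \<omega> u < F \<omega> (V \<omega>) + e"
      using cont[OF that(1), of "V \<omega>"] that(2)
      by (intro order_tendstoD(2)[where y = "F \<omega> (V \<omega>)"]) (auto simp: isCont_def tendsto_at_iff_tendsto_nhds)
    then obtain r where "r > 0" and r: "\<And>u. dist u (V \<omega>) < r \<Longrightarrow> F \<omega> u < F \<omega> (V \<omega>) + e"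
      by (auto simp: eventually_nhds_metric)
    obtain x where "x \<in> D" "dist x (V \<omega>) < r"
      using D[OF V(1)[OF \<open>\<omega> \<in> space P\<close>] \<open>r > 0\<close>] by blast
    moreover obtain n where "x = d n"
      using from_nat_into_surj[OF \<open>countable D\<close> \<open>x \<in> D\<close>] by (auto simp: d_def)
    ultimately show ?thesis using r by blast
  qed
  \<comment> \<open>Comparing \<open>d n\<close> with all \<open>d i\<close> rather than with the minimum value keeps the condition visibly
    measurable; by density and continuity it amounts to the same.\<close>
  define near where "near j \<omega> n \<longleftrightarrow> (\<forall>i. F \<omega> (d n) \<le> F \<omega> (d i) + 1 / real (Suc j))" for j \<omega> n
  define N where "N j \<omega> = (LEAST n. near j \<omega> n)" for j \<omega>
  have N: "F \<omega> (d (N j \<omega>)) - F \<omega> (V \<omega>) \<le> 1 / real (Suc j)" if \<omega>: "\<omega> \<in> space P" for j \<omega>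
  proof (rule ccontr)
    obtain n where n: "F \<omega> (d n) < F \<omega> (V \<omega>) + 1 / real (Suc j)"
      using approx[OF \<omega>, of "1 / real (Suc j)"] by auto
    have "F \<omega> (d n) \<le> F \<omega> (d i) + 1 / real (Suc j)" for i
      using n V(2)[OF \<omega> d, of i] by linarith
    then have "near j \<omega> n" by (simp add: near_def)
    then have "near j \<omega> (N j \<omega>)" unfolding N_def by (rule LeastI)
    then have *: "F \<omega> (d (N j \<omega>)) \<le> F \<omega> (d i) + 1 / real (Suc j)" for i
      by (simp add: near_def)
    assume "\<not> ?thesis"
    then obtain i where "F \<omega> (d i) < F \<omega> (V \<omega>) + (F \<omega> (d (N j \<omega>)) - 1 / real (Suc j) - F \<omega> (V \<omega>))"
      using approx[OF \<omega>, of "F \<omega> (d (N j \<omega>)) - 1 / real (Suc j) - F \<omega> (V \<omega>)"] by auto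
    with *[of i] show False by linarith
  qed
  have "(\<lambda>\<omega>. F \<omega> (d n)) \<in> borel_measurable P" for n
    using meas d by simp
  note [measurable] = this
  have "Measurable.pred P (\<lambda>\<omega>. near j \<omega> n)" for j n
    unfolding near_def by measurable
  note [measurable] = this
  have "N j \<in> measurable P (count_space UNIV)" for j
    unfolding N_def by measurable
  then have dN: "(\<lambda>\<omega>. d (N j \<omega>)) \<in> borel_measurable P" for j
    by (rule measurable_compose) simp
  have growth: "\<exists>b>0. \<forall>u\<in>A. b * (norm (u - V \<omega>))\<^sup>2 \<le> F \<omega> u - F \<omega> (V \<omega>)"
    if "\<omega> \<in> space P" for \<omega>
    by (rule strongly_convex_quadratic_growth[OF sc[OF that] A(2) V[OF that]]) blast+
  have lim: "(\<lambda>j. d (N j \<omega>)) \<longlonglongrightarrow> V \<omega>" if \<omega>: "\<omega> \<in> space P" for \<omega>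
  proof -
    obtain b where "b > 0" and b: "\<And>u. u \<in> A \<Longrightarrow> b * (norm (u - V \<omega>))\<^sup>2 \<le> F \<omega> u - F \<omega> (V \<omega>)"
      using growth[OF \<omega>] by blast
    have "b * (norm (d (N j \<omega>) - V \<omega>))\<^sup>2 \<le> 1 / real (Suc j)" for j
      using b[OF d, of "N j \<omega>"] N[OF \<omega>, of j] by linarith
    then have upper: "(norm (d (N j \<omega>) - V \<omega>))\<^sup>2 \<le> 1 / real (Suc j) / b" for j
      by (subst pos_le_divide_eq[OF \<open>b > 0\<close>]) (simp only: mult.commute)
    have upper_lim: "(\<lambda>j. 1 / real (Suc j) / b) \<longlonglongrightarrow> 0"
      using tendsto_divide[OF LIMSEQ_Suc[OF lim_1_over_n] tendsto_const[of b]] \<open>b > 0\<close> by simp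
    have "(\<lambda>j. (norm (d (N j \<omega>) - V \<omega>))\<^sup>2) \<longlonglongrightarrow> 0"
      by (rule tendsto_sandwich[OF _ _ tendsto_const upper_lim])
        (intro always_eventually allI zero_le_power2 upper)+
    then have "(\<lambda>j. sqrt ((norm (d (N j \<omega>) - V \<omega>))\<^sup>2)) \<longlonglongrightarrow> sqrt 0"
      by (rule tendsto_real_sqrt)
    then show ?thesis
      by (simp add: LIM_zero_iff tendsto_norm_zero_iff)
  qed
  show ?thesis
  proof
    show "V \<in> borel_measurable P"
      using borel_measurable_LIMSEQ_metric[OF dN lim] .
    fix \<omega> assume \<omega>: "\<omega> \<in> space P"
    obtain b where "b > 0" and b: "\<And>u. u \<in> A \<Longrightarrow> b * (norm (u - V \<omega>))\<^sup>2 \<le> F \<omega> u - F \<omega> (V \<omega>)"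
      using growth[OF \<omega>] by blast
    have "u = V \<omega>" if "u \<in> A" "F \<omega> u \<le> F \<omega> (V \<omega>)" for u
    proof -
      have "b * (norm (u - V \<omega>))\<^sup>2 \<le> 0" using b[OF that(1)] that(2) by linarith
      then show ?thesis using \<open>b > 0\<close> by (simp add: mult_le_0_iff)
    qed
    then show "{u. is_arg_min (F \<omega>) (\<lambda>u. u \<in> A) u} = {V \<omega>}"
      using V[OF \<omega>] by (auto simp: is_arg_min_linorder)
  qed
qed

section \<open>Measurability of the terms of the objective\<close>

lemma has_gateaux_gradient_unique:
  assumes "has_gateaux_gradient f g u" "has_gateaux_gradient f h u"
  shows "g = h"
proof (rule blinfun_eqI)
  fix v
  show "blinfun_apply g v = blinfun_apply h v"
    by (rule tendsto_unique[OF at_neq_bot assms(1)[unfolded has_gateaux_gradient_def, rule_format]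
          assms(2)[unfolded has_gateaux_gradient_def, rule_format]])
qed

lemma has_gateaux_gradient_gateaux_gradient:
  assumes "has_gateaux_gradient f g u"
  shows "has_gateaux_gradient f (gateaux_gradient f u) u"
proof -
  have "gateaux_gradient f u = g"
    unfolding gateaux_gradient_def
    by (rule the_equality[of "\<lambda>g. has_gateaux_gradient f g u", OF assms])
      (rule has_gateaux_gradient_unique[OF _ assms])
  with assms show ?thesis by simp
qed

text \<open>Gateaux differentiability controls the gradient one direction \<open>h\<close> at a time, so measurability is
  obtained for the pairing with \<open>h\<close>, a pointwise limit of difference quotients along \<open>1 / Suc n\<close>.\<close>

lemma borel_measurable_gateaux_gradient_apply:
  fixes K :: "'u::real_normed_vector \<Rightarrow> real"
  assumes cont: "continuous_on UNIV K" and V: "V \<in> borel_measurable P"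
    and grad: "\<And>\<omega>. \<omega> \<in> space P \<Longrightarrow> \<exists>g. has_gateaux_gradient K g (V \<omega>)"
  shows "(\<lambda>\<omega>. blinfun_apply (gateaux_gradient K (V \<omega>)) h) \<in> borel_measurable P"
proof (rule borel_measurable_LIMSEQ_metric)
  fix n :: nat
  define t where "t = 1 / real (Suc n)"
  have "continuous_on UNIV (\<lambda>u. (K (u + t *\<^sub>R h) - K u) / t)"
    by (intro continuous_intros continuous_on_compose2[OF cont]) (auto simp: t_def)
  then have "(\<lambda>\<omega>. (K (V \<omega> + t *\<^sub>R h) - K (V \<omega>)) / t) \<in> borel_measurable P"
    using V by (rule borel_measurable_continuous_on)
  then show "(\<lambda>\<omega>. (K (V \<omega> + (1 / real (Suc n)) *\<^sub>R h) - K (V \<omega>)) / (1 / real (Suc n)))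
      \<in> borel_measurable P"
    unfolding t_def .
next
  fix \<omega> assume "\<omega> \<in> space P"
  then have "((\<lambda>t. (K (V \<omega> + t *\<^sub>R h) - K (V \<omega>)) / t)
      \<longlongrightarrow> blinfun_apply (gateaux_gradient K (V \<omega>)) h) (at 0)"
    using grad has_gateaux_gradient_gateaux_gradient unfolding has_gateaux_gradient_def by blast
  moreover have "filterlim (\<lambda>n. 1 / real (Suc n)) (at 0) sequentially"
    using LIMSEQ_Suc[OF lim_1_over_n] by (auto simp: filterlim_at)
  ultimately show "(\<lambda>n. (K (V \<omega> + (1 / real (Suc n)) *\<^sub>R h) - K (V \<omega>)) / (1 / real (Suc n)))
      \<longlonglongrightarrow> blinfun_apply (gateaux_gradient K (V \<omega>)) h"
    by (rule filterlim_compose)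
qed

text \<open>This lets dual-valued maps be paired with \<open>u\<close> before they are added: in a nonseparable dual a sum
  of two Borel maps need not be Borel, whereas the sum of the real-valued pairings is.\<close>

lemma borel_measurable_blinfun_apply:
  fixes X :: "'a \<Rightarrow> 'u::real_normed_vector \<Rightarrow>\<^sub>L real"
  assumes "X \<in> borel_measurable P"
  shows "(\<lambda>\<omega>. blinfun_apply (X \<omega>) u) \<in> borel_measurable P"
  by (rule borel_measurable_continuous_on[OF _ assms]) (intro continuous_intros)

text \<open>One step of the recursion.  With \<open>e \<ge> 0\<close> everything added to \<open>K\<close> is convex, and everything but
  \<open>K\<close> and \<open>jS\<close> is affine in \<open>u\<close>.\<close>

lemma measurable_app_arg_min:
  fixes Uad :: "'u::banach set" and K :: "'u \<Rightarrow> real"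
    and jS :: "'u \<Rightarrow> 'w::topological_space \<Rightarrow> real"
  assumes sep: "separable_space (euclidean :: 'u topology)"
    and Uad: "closed Uad" "convex Uad" "Uad \<noteq> {}"
    and jS: "lower_semicontinuous (\<lambda>(u, w). jS u w)" "\<And>w. convex_on UNIV (\<lambda>u. jS u w)"
    and K: "strongly_convex K" "lower_semicontinuous K"
    and grad: "\<And>u. u \<in> Uad \<Longrightarrow> \<exists>g. has_gateaux_gradient K g u"
    and "e \<ge> 0"
    and U: "U \<in> borel_measurable P" "\<And>\<omega>. \<omega> \<in> space P \<Longrightarrow> U \<omega> \<in> Uad"
    and G: "G \<in> borel_measurable P" and R: "R \<in> borel_measurable P" and W: "W \<in> borel_measurable P"
  obtains V where "V \<in> borel_measurable P"
    and "\<And>\<omega>. \<omega> \<in> space P \<Longrightarrow>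
      {u. is_arg_min (app_objective K jS e (U \<omega>) (G \<omega>) (R \<omega>) (W \<omega>)) (\<lambda>u. u \<in> Uad) u} = {V \<omega>}"
proof (rule measurable_strongly_convex_arg_min[OF sep Uad])
  have K_cont: "continuous_on UNIV K"
    using convex_lower_semicontinuous_imp_continuous[OF strongly_convex_imp_convex] K by blast
  fix \<omega>
  have "continuous_on UNIV (\<lambda>u. jS u (W \<omega>))"
    by (intro convex_lower_semicontinuous_imp_continuous jS(2) lower_semicontinuous_section(1)[OF jS(1)])
  then show "lower_semicontinuous (app_objective K jS e (U \<omega>) (G \<omega>) (R \<omega>) (W \<omega>))"
    unfolding app_objective_def[abs_def]
    by (intro continuous_imp_lower_semicontinuous continuous_intros K_cont)
  have "convex_on UNIV (\<lambda>u. blinfun_apply g u + e * jS u (W \<omega>))" for g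
    using \<open>e \<ge> 0\<close>
    by (intro convex_on_add convex_on_cmul jS(2)) (auto intro!: convex_onI simp: blinfun.bilinear_simps)
  then show "strongly_convex (app_objective K jS e (U \<omega>) (G \<omega>) (R \<omega>) (W \<omega>))"
    using strongly_convex_add_convex[OF K(1)] unfolding app_objective_def[abs_def]
    by (simp add: add.assoc)
next
  have K_cont: "continuous_on UNIV K"
    using convex_lower_semicontinuous_imp_continuous[OF strongly_convex_imp_convex] K by blast
  fix u
  have [measurable]: "(\<lambda>\<omega>. blinfun_apply (gateaux_gradient K (U \<omega>)) u) \<in> borel_measurable P"
    using borel_measurable_gateaux_gradient_apply[OF K_cont U(1)] grad U(2) by blast
  have [measurable]: "(\<lambda>\<omega>. blinfun_apply (G \<omega>) u) \<in> borel_measurable P"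
      "(\<lambda>\<omega>. blinfun_apply (R \<omega>) u) \<in> borel_measurable P"
    using G R by (auto intro: borel_measurable_blinfun_apply)
  have [measurable]: "(\<lambda>\<omega>. jS u (W \<omega>)) \<in> borel_measurable P"
    using borel_measurable_lower_semicontinuous[OF lower_semicontinuous_section(2)[OF jS(1)]]
    by (rule measurable_compose[OF W])
  show "(\<lambda>\<omega>. app_objective K jS e (U \<omega>) (G \<omega>) (R \<omega>) (W \<omega>) u) \<in> borel_measurable P"
    unfolding app_objective_def blinfun.bilinear_simps by measurable
qed (use that in blast)

section \<open>Iterates of the stochastic auxiliary problem principle\<close>

theorem corollary3p28:
  fixes P :: "'a measure"
    and Uad :: "'u::banach set"
    and K :: "'u \<Rightarrow> real"
    and jC jS :: "'u \<Rightarrow> 'w::real_topological_vector_space \<Rightarrow> real"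
    and \<epsilon> :: "nat \<Rightarrow> real"
    and W :: "nat \<Rightarrow> 'a \<Rightarrow> 'w"
    and R G :: "nat \<Rightarrow> 'a \<Rightarrow> 'u \<Rightarrow>\<^sub>L real"
    and u0 :: 'u
    and M :: "nat \<Rightarrow> 'a \<Rightarrow> 'u set"
    and U :: "nat \<Rightarrow> 'a \<Rightarrow> 'u"
  assumes "reflexive_space TYPE('u)"
    and "separable_space (euclidean :: 'u topology)"
    and "prob_space P" and "complete_measure P"
    and "Uad \<noteq> {}" and "closed Uad" and "convex Uad"
    and "lower_semicontinuous (\<lambda>(u, w). jC u w)"
    and "lower_semicontinuous (\<lambda>(u, w). jS u w)"
    and "\<And>w. proper_fun (\<lambda>u. ereal (jC u w))" and "\<And>w. convex_on UNIV (\<lambda>u. jC u w)"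
    and "\<And>w. proper_fun (\<lambda>u. ereal (jS u w))" and "\<And>w. convex_on UNIV (\<lambda>u. jS u w)"
    and "\<And>w. \<exists>S. open S \<and> Uad \<subseteq> S \<and> (\<forall>u\<in>S. subdifferential (\<lambda>v. jC v w) u \<noteq> {})"
    and "proper_fun (\<lambda>u. ereal (K u))" and "convex_on UNIV K" and "lower_semicontinuous K"
    and "\<exists>S. open S \<and> Uad \<subseteq> S \<and> (\<forall>u\<in>S. \<exists>g. has_gateaux_gradient K g u)"
    and "\<And>k. k \<ge> 1 \<Longrightarrow> W k \<in> borel_measurable P"
    and "prob_space.indep_vars P (\<lambda>_. borel) W {1..}"
    and "\<And>i j. i \<ge> 1 \<Longrightarrow> j \<ge> 1 \<Longrightarrow> distr P borel (W i) = distr P borel (W j)"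
    and "\<And>k. R k \<in> borel_measurable P"
    and "\<And>k. \<epsilon> k > 0"
    and "u0 \<in> Uad"
    and "stochastic_app_run P Uad K jC jS \<epsilon> W R u0 M U G"
    and "\<And>k \<omega>. measurable_selection P (M k) (U k) \<Longrightarrow> \<omega> \<in> space P \<Longrightarrow>
      coercive_on Uad (app_objective K jS (\<epsilon> k) (U k \<omega>) (G k \<omega>) (R k \<omega>) (W (Suc k) \<omega>))"
    and "strongly_convex K"
  shows "\<forall>k. (\<forall>\<omega>\<in>space P. M k \<omega> = {U k \<omega>}) \<and> U k \<in> measurable P (restrict_space borel Uad)"
proof -
  note run = \<open>stochastic_app_run P Uad K jC jS \<epsilon> W R u0 M U G\<close>[unfolded stochastic_app_run_def]
  have M0: "M 0 \<omega> = {u0}" if "\<omega> \<in> space P" for \<omega>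
    using run that by blast
  have selection: "measurable_selection P (M k) (U k)" if "measurable_selection P (M k) V" for k V
    using run that by blast
  have step: "G k \<in> borel_measurable P"
      "\<And>\<omega>. \<omega> \<in> space P \<Longrightarrow> M (Suc k) \<omega> = {u. is_arg_min
         (app_objective K jS (\<epsilon> k) (U k \<omega>) (G k \<omega>) (R k \<omega>) (W (Suc k) \<omega>)) (\<lambda>u. u \<in> Uad) u}"
    if "measurable_selection P (M k) (U k)" for k
    using run that by blast+
  have grad: "\<exists>g. has_gateaux_gradient K g u" if "u \<in> Uad" for u
    using assms(18) that by blast
  \<comment> \<open>Membership in \<open>Uad\<close> is carried along because \<open>K\<close> is assumed differentiable only near \<open>Uad\<close>.\<close>
  have iterate: "U k \<in> borel_measurable P \<and> (\<forall>\<omega>\<in>space P. M k \<omega> = {U k \<omega>} \<and> U k \<omega> \<in> Uad)" for k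
  proof (induction k)
    case 0
    \<comment> \<open>The run selects \<open>U k\<close> only once some measurable selection is known to exist.\<close>
    have "measurable_selection P (M 0) (\<lambda>_. u0)"
      using M0 by (simp add: measurable_selection_def)
    from selection[OF this] show ?case
      using M0 \<open>u0 \<in> Uad\<close> by (auto simp: measurable_selection_def)
  next
    case (Suc k)
    then have sel: "measurable_selection P (M k) (U k)"
      by (simp add: measurable_selection_def)
    obtain V where V: "V \<in> borel_measurable P"
      and argmin: "\<And>\<omega>. \<omega> \<in> space P \<Longrightarrow> {u. is_arg_min
        (app_objective K jS (\<epsilon> k) (U k \<omega>) (G k \<omega>) (R k \<omega>) (W (Suc k) \<omega>)) (\<lambda>u. u \<in> Uad) u} = {V \<omega>}"
      using measurable_app_arg_min[OF \<open>separable_space euclidean\<close> \<open>closed Uad\<close> \<open>convex Uad\<close>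
          \<open>Uad \<noteq> {}\<close> assms(9,13) \<open>strongly_convex K\<close> \<open>lower_semicontinuous K\<close> grad, of "\<epsilon> k" "U k" P "G k" "R k" "W (Suc k)"]
        Suc step(1)[OF sel] assms(19)[of "Suc k"] assms(22,23) less_imp_le by (metis le_add1 plus_1_eq_Suc)
    have M: "M (Suc k) \<omega> = {V \<omega>}" "V \<omega> \<in> Uad" if "\<omega> \<in> space P" for \<omega>
    proof -
      show "M (Suc k) \<omega> = {V \<omega>}"
        using step(2)[OF sel that] argmin[OF that] by simp
      have "V \<omega> \<in> {u. is_arg_min
        (app_objective K jS (\<epsilon> k) (U k \<omega>) (G k \<omega>) (R k \<omega>) (W (Suc k) \<omega>)) (\<lambda>u. u \<in> Uad) u}"
        unfolding argmin[OF that] by simp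
      then show "V \<omega> \<in> Uad" by (simp add: is_arg_min_def)
    qed
    have "measurable_selection P (M (Suc k)) V"
      using V M by (simp add: measurable_selection_def)
    from selection[OF this] show ?case
      using M by (auto simp: measurable_selection_def)
  qed
  then show ?thesis
    by (auto intro!: measurable_restrict_space2)
qed

end
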